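(* Suppose a prepoint $p$ generously names internal atoms. Let $\mathcal A,\mathcal B$ be sets of internal predicates and $\Gamma,\Delta$ contexts. Then (1) if $\Gamma\vdash\Delta$ is derivable then $p\models(\Gamma\vdash\Delta)$; and (2) if $\mathcal A\vdash\mathcal B$ then $p\models(\mathcal A\vdash\mathcal B)$.
   Context: Atoms: for each $i\in\mathbb Z$ a set $\mathbb A_i$ of atoms (pairwise disjoint, each of cardinality $\beth_\omega$); small = cardinality $<\beth_\omega$, generous = cardinality $\beth_\omega$; $\mathsf N a'\in\mathbb A_i.\Phi(a')$ means $\{a'\in\mathbb A_i:\Phi(a')\}$ has small complement in $\mathbb A_i$. $(a\,b)$ swaps atoms of equal level. Internal syntax (binders $[a]$ up to $\alpha$-equivalence): internal predicates $\wedge(\mathcal X)$ ($\mathcal X$ finite), $\neg X$, $\forall[a]X$, $\in(x,a)$ with $a\in\mathbb A_{i+1}$, $x\in\mathcal L_i$; internal sets of level $i$ ($\mathcal L_i$): $\mathrm{atm}(a)$ ($a\in\mathbb A_i$), $[a]X$ ($a\in\mathbb A_{i-1}$). $a\#Z$: $a$ not free in $Z$. Substitution $Z[a\mapsto x]$ ($a\in\mathbb A_i$, $x\in\mathcal L_i$): $\wedge(\mathcal X)[a\mapsto x]=\wedge\{X[a\mapsto x]\}$; $(\neg X)[a\mapsto x]=\neg(X[a\mapsto x])$; $(\forall[b]X)[a\mapsto x]=\forall[b](X[a\mapsto x])$ for $b\#x$; $\in(y,a)[a\mapsto\mathrm{atm}(n)]=\in(y[a\mapsto\mathrm{atm}(n)],n)$;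 $\in(y,a)[a\mapsto[a']X]=X[a'\mapsto y[a\mapsto[a']X]]$ ($a'$ fresh); $\in(y,b)[a\mapsto x]=\in(y[a\mapsto x],b)$ for $b\ne a$; $\mathrm{atm}(a)[a\mapsto x]=x$; $\mathrm{atm}(b)[a\mapsto x]=\mathrm{atm}(b)$; $([c]X)[a\mapsto x]=[c](X[a\mapsto x])$ for $c\#x$. Write $X[a\mapsto a']$ for $X[a\mapsto\mathrm{atm}(a')]$. $\bot$ denotes $\neg\wedge(\varnothing)$. Prepoints: subsets $p$ of $\bigcup_i\mathbb A_i\times\mathcal L_{i-1}$ (elements $a\triangleright y$). Validity: $p\models\wedge(\mathcal X)$ iff all $p\models X$; $p\models\neg X$ iff not $p\models X$; $p\models\forall[a]X$ iff $\mathsf N a'\in\mathbb A_{\mathrm{level}(a)}.\,p\models(a'\,a)\cdot X$; $p\models\in(y,a)$ iff $a\triangleright y\in p$. $p$ generously names internal atoms if for every atom $a'$, every $a\in\mathbb A_{\mathrm{level}(a')}$ and every internal predicate $X$, the set $\{a''\in\mathbb A_{\mathrm{level}(a')}:p\models(a''\,a)\cdot X\iff p\models X[a\mapsto a']\}$ is generous. Entailment: contexts are finite sets of internal predicates (comma = union). $\Gamma\vdash\Delta$ is defined inductively by the rules: ($\wedge$L) from $\Gamma,\mathcal X\vdash\Delta$ infer $\Gamma,\wedge(\mathcal X)\vdash\Delta$; ($\wedge$R) from $\Gamma\vdash X,\Delta$ for every $X\in\mathcal X$ infer $\Gamma\vdash\wedge(\mathcal X),\Delta$; ($\neg$L) from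 $\Gamma\vdash X,\Delta$ infer $\Gamma,\neg X\vdash\Delta$; ($\neg$R) from $\Gamma,X\vdash\Delta$ infer $\Gamma\vdash\neg X,\Delta$; ($\forall$L) from $\Gamma,X[a\mapsto a']\vdash\Delta$ (any $a'$ of the level of $a$, possibly $a'=a$) infer $\Gamma,\forall[a]X\vdash\Delta$; ($\forall$R) from $\mathsf N a'.(\Gamma\vdash(a'\,a)\cdot X,\Delta)$ infer $\Gamma\vdash\forall[a]X,\Delta$; (Ax) $\Gamma,X\vdash X,\Delta$; (Cut) from $\Gamma,X\vdash\Delta$ and $\Gamma\vdash X,\Delta$ infer $\Gamma\vdash\Delta$. For sets $\mathcal A,\mathcal B$ of internal predicates, $\mathcal A\vdash\mathcal B$ means $\Gamma\vdash\Delta$ is derivable for some finite $\Gamma\subseteq\mathcal A$, $\Delta\subseteq\mathcal B$. $p\models(\mathcal A\vdash\mathcal B)$ means: if $p\models X$ for all $X\in\mathcal A$ then $p\models Y$ for some $Y\in\mathcal B$. *)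

theory Defs
  imports "HOL-Library.FSet" "HOL-Combinatorics.Transposition"
begin

unbundle cardinal_syntax

text \<open>\<open>has_card_beth n B\<close> says that \<open>B\<close> has cardinality \<open>beth n\<close> (\<open>beth 0\<close> is the cardinality of the
  natural numbers, \<open>beth (n + 1) = 2 ^ beth n\<close>), and \<open>has_card_beth_omega A\<close> that the cardinality of
  \<open>A\<close> is the supremum of the \<open>beth n\<close>. Every cardinal below that of \<open>A\<close> is the cardinality of a
  subset of \<open>A\<close>, so it suffices to compare with sets over the same type.\<close>

primrec has_card_beth :: "nat \<Rightarrow> 'a set \<Rightarrow> bool" where
  "has_card_beth 0 B \<longleftrightarrow> |B| =o natLeq"
| "has_card_beth (Suc n) B \<longleftrightarrow> (\<exists>C. has_card_beth n C \<and> |B| =o |Pow C| )"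

definition has_card_beth_omega :: "'a set \<Rightarrow> bool" where
  "has_card_beth_omega A \<longleftrightarrow> (\<exists>B :: nat \<Rightarrow> 'a set.
     (\<forall>n. has_card_beth n (B n)) \<and> (\<forall>n. |B n| \<le>o |A| ) \<and>
     (\<forall>C :: 'a set. (\<forall>n. |B n| \<le>o |C| ) \<longrightarrow> |A| \<le>o |C| ))"

lemma has_card_beth_omega_infinite: "has_card_beth_omega A \<Longrightarrow> infinite A"
proof -
  assume "has_card_beth_omega A"
  then obtain B :: "nat \<Rightarrow> 'a set" where "has_card_beth 0 (B 0)" "|B 0| \<le>o |A|"
    unfolding has_card_beth_omega_def by blast
  then have "natLeq \<le>o |A|" by (auto intro: ordIso_ordLeq_trans ordIso_symmetric)
  then show ?thesis using infinite_iff_natLeq_ordLeq by blast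
qed

text \<open>The atoms of all levels form one type; the sets of atoms of the various levels are the fibres of
  \<open>level\<close>, hence pairwise disjoint. The existence of a type with this property is not provable in HOL,
  since no HOL type has provably \<open>beth_omega\<close> elements; it is assumed as a class axiom.\<close>

class atoms =
  fixes level :: "'a \<Rightarrow> int"
  assumes has_card_beth_omega_level: "has_card_beth_omega {a. level a = i}"

definition atoms_at :: "int \<Rightarrow> 'a::atoms set" (\<open>\<A>\<close>) where
  "\<A> i = {a. level a = i}"

lemma in_atoms_at [simp]: "a \<in> \<A> i \<longleftrightarrow> level a = i"
  by (simp add: atoms_at_def)

definition small :: "'a::atoms set \<Rightarrow> bool" where
  "small S \<longleftrightarrow> (\<exists>C :: 'a set. has_card_beth_omega C \<and> |S| <o |C| )"

definition generous :: "'a::atoms set \<Rightarrow> bool" where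
  "generous S \<longleftrightarrow> has_card_beth_omega S"

definition New :: "int \<Rightarrow> ('a::atoms \<Rightarrow> bool) \<Rightarrow> bool" where
  "New i \<Phi> \<longleftrightarrow> small (\<A> i - {a \<in> \<A> i. \<Phi> a})"

lemma infinite_atoms_at [simp]: "infinite (\<A> i :: 'a::atoms set)"
  using has_card_beth_omega_infinite[OF has_card_beth_omega_level, of i] by (simp add: atoms_at_def)

lemma finite_small: "finite S \<Longrightarrow> small (S :: 'a::atoms set)"
  unfolding small_def
  using finite_ordLess_infinite[of "|S|" "|\<A> 0 :: 'a set|"] has_card_beth_omega_level[of 0]
  by (metis Field_card_of atoms_at_def card_of_Well_order infinite_atoms_at)

lemma small_subset: "small T \<Longrightarrow> S \<subseteq> T \<Longrightarrow> small S"
  unfolding small_def using card_of_mono1 ordLeq_ordLess_trans by blast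

lemma has_card_beth_unique:
  fixes B B' :: "'a set"
  shows "has_card_beth n B \<Longrightarrow> has_card_beth n B' \<Longrightarrow> |B| =o |B'|"
proof (induction n arbitrary: B B')
  case 0
  then show ?case by (auto intro: ordIso_transitive ordIso_symmetric)
next
  case (Suc n)
  from Suc.prems obtain C :: "'a set" where C: "has_card_beth n C" "|B| =o |Pow C|" by auto
  from Suc.prems obtain D :: "'a set" where D: "has_card_beth n D" "|B'| =o |Pow D|" by auto
  have "\<exists>f. bij_betw f C D" unfolding card_of_ordIso by (rule Suc.IH[OF C(1) D(1)])
  then obtain f where "bij_betw f C D" ..
  then have "|Pow C| =o |Pow D|" by (rule card_of_ordIsoI[OF bij_betw_Pow])
  then show ?case
    by (rule ordIso_transitive[OF C(2) ordIso_transitive[OF _ ordIso_symmetric[OF D(2)]]])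
qed

lemma has_card_beth_omega_unique:
  fixes A A' :: "'a set"
  assumes "has_card_beth_omega A" "has_card_beth_omega A'"
  shows "|A| =o |A'|"
proof -
  have *: "|A| \<le>o |A'|" if A: "has_card_beth_omega A" and A': "has_card_beth_omega A'"
    for A A' :: "'a set"
  proof -
    from A obtain B :: "nat \<Rightarrow> 'a set" where B: "(\<forall>n. has_card_beth n (B n)) \<and> (\<forall>n. |B n| \<le>o |A| ) \<and>
       (\<forall>C :: 'a set. (\<forall>n. |B n| \<le>o |C| ) \<longrightarrow> |A| \<le>o |C| )"
      unfolding has_card_beth_omega_def by (elim exE)
    from A' obtain B' :: "nat \<Rightarrow> 'a set" where B': "(\<forall>n. has_card_beth n (B' n)) \<and> (\<forall>n. |B' n| \<le>o |A'| ) \<and>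
       (\<forall>C :: 'a set. (\<forall>n. |B' n| \<le>o |C| ) \<longrightarrow> |A'| \<le>o |C| )"
      unfolding has_card_beth_omega_def by (elim exE)
    have "|B n| \<le>o |A'|" for n
      using ordIso_ordLeq_trans[OF has_card_beth_unique[of n "B n" "B' n"], of "|A'|"] B B' by simp
    then show ?thesis using B[THEN conjunct2, THEN conjunct2, THEN spec, of A'] by blast
  qed
  show ?thesis unfolding ordIso_iff_ordLeq by (intro conjI *[OF assms] *[OF assms(2,1)])
qed

lemma small_Un: "small S \<Longrightarrow> small T \<Longrightarrow> small (S \<union> T :: 'a::atoms set)"
proof -
  assume "small S" "small T"
  then obtain C D :: "'a set" where
    "has_card_beth_omega C" "|S| <o |C|" "has_card_beth_omega D" "|T| <o |D|"
    unfolding small_def by blast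
  moreover from this have "|T| <o |C|"
    using has_card_beth_omega_unique ordLess_ordIso_trans by blast
  ultimately show ?thesis
    unfolding small_def using card_of_Un_ordLess_infinite has_card_beth_omega_infinite by blast
qed

lemma New_mono: "New i P \<Longrightarrow> (\<And>a. level a = i \<Longrightarrow> P a \<Longrightarrow> Q a) \<Longrightarrow> New i Q"
  unfolding New_def by (erule small_subset) auto

lemma New_mono' [mono]: "(\<And>a. P a \<longrightarrow> Q a) \<Longrightarrow> New i P \<longrightarrow> New i Q"
  by (blast intro: New_mono)

lemma New_cong [fundef_cong]:
  "i = j \<Longrightarrow> (\<And>a. level a = j \<Longrightarrow> P a = Q a) \<Longrightarrow> New i P = New j Q"
  by (metis New_mono)

lemma New_iff_finite:
  "finite {a \<in> \<A> i. P a \<noteq> Q a} \<Longrightarrow> New i P \<longleftrightarrow> New i Q"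
proof -
  have *: "New i Q" if "New i P" "finite {a \<in> \<A> i. P a \<noteq> Q a}" for P Q :: "'a \<Rightarrow> bool"
  proof -
    have "small ((\<A> i - {a \<in> \<A> i. P a}) \<union> {a \<in> \<A> i. P a \<noteq> Q a})"
      using that finite_small small_Un unfolding New_def by blast
    then show ?thesis unfolding New_def by (rule small_subset) auto
  qed
  assume fin: "finite {a \<in> \<A> i. P a \<noteq> Q a}"
  moreover have "{a \<in> \<A> i. Q a \<noteq> P a} = {a \<in> \<A> i. P a \<noteq> Q a}" by auto
  ultimately show ?thesis using *[of P Q] *[of Q P] by metis
qed

text \<open>The swapping is only ever used for atoms of equal level. Making it the identity otherwise keeps it
  level-preserving for all arguments.\<close>

definition swp :: "'a::atoms \<Rightarrow> 'a \<Rightarrow> 'a \<Rightarrow> 'a" where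
  "swp a b = (if level a = level b then Transposition.transpose a b else id)"

text \<open>Raw internal predicates and internal sets: before imposing the level conditions (\<open>wf_rpred\<close>,
  \<open>wf_rset\<close>) and before identifying \<open>\<alpha>\<close>-equivalent terms. \<open>map_rpred \<pi>\<close> and \<open>map_rset \<pi>\<close> rename all
  atoms, including the bound ones.\<close>

datatype 'a rpred =
    RAnd "'a rpred fset"
  | RNeg "'a rpred"
  | RAll 'a "'a rpred"
  | RMem "'a rset" 'a
and 'a rset =
    RAtm 'a
  | RAbs 'a "'a rpred"

primrec rset_level :: "'a::atoms rset \<Rightarrow> int" where
  "rset_level (RAtm a) = level a"
| "rset_level (RAbs a X) = level a + 1"

inductive wf_rpred :: "'a::atoms rpred \<Rightarrow> bool" and wf_rset :: "'a::atoms rset \<Rightarrow> bool" where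
  "(\<And>X. X |\<in>| XX \<Longrightarrow> wf_rpred X) \<Longrightarrow> wf_rpred (RAnd XX)"
| "wf_rpred X \<Longrightarrow> wf_rpred (RNeg X)"
| "wf_rpred X \<Longrightarrow> wf_rpred (RAll a X)"
| "wf_rset x \<Longrightarrow> level a = rset_level x + 1 \<Longrightarrow> wf_rpred (RMem x a)"
| "wf_rset (RAtm a)"
| "wf_rpred X \<Longrightarrow> wf_rset (RAbs a X)"

definition cofin :: "int \<Rightarrow> ('a::atoms \<Rightarrow> bool) \<Rightarrow> bool" where
  "cofin i P \<longleftrightarrow> finite {a \<in> \<A> i. \<not> P a}"

lemma cofin_mono: "cofin i P \<Longrightarrow> (\<And>a. level a = i \<Longrightarrow> P a \<Longrightarrow> Q a) \<Longrightarrow> cofin i Q"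
  unfolding cofin_def by (erule finite_subset[rotated]) auto

lemma cofin_mono' [mono]: "(\<And>a. P a \<longrightarrow> Q a) \<Longrightarrow> cofin i P \<longrightarrow> cofin i Q"
  by (blast intro: cofin_mono)

lemma cofin_conj: "cofin i P \<Longrightarrow> cofin i Q \<Longrightarrow> cofin i (\<lambda>a. P a \<and> Q a)"
  unfolding cofin_def by (erule (1) finite_subset[OF _ finite_UnI, rotated]) auto

lemma cofin_notin: "finite F \<Longrightarrow> cofin i (\<lambda>a. a \<notin> F)"
  unfolding cofin_def by (erule finite_subset[rotated]) auto

lemma cofin_ex: "cofin i P \<Longrightarrow> \<exists>a. level a = i \<and> P a"
proof (rule ccontr)
  assume "cofin i P" "\<nexists>a. level a = i \<and> P a"
  then have "{a \<in> \<A> i. \<not> P a} = \<A> i" "finite {a \<in> \<A> i. \<not> P a}" by (auto simp: cofin_def)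
  then show False using infinite_atoms_at by metis
qed

lemma fset_rel_mono' [mono]:
  "(\<And>x y. P x y \<longrightarrow> Q x y) \<Longrightarrow> rel_fset P xs ys \<longrightarrow> rel_fset Q xs ys"
  using fset.rel_mono_strong by blast

text \<open>\<open>\<alpha>\<close>-equivalence in its nominal form: \<open>[a]X\<close> and \<open>[b]Y\<close> are equivalent iff \<open>(c a) X\<close> and
  \<open>(c b) Y\<close> are, for all but finitely many atoms \<open>c\<close> of the level of \<open>a\<close> and \<open>b\<close>.\<close>

inductive alpha_p :: "'a::atoms rpred \<Rightarrow> 'a rpred \<Rightarrow> bool"
  and alpha_s :: "'a::atoms rset \<Rightarrow> 'a rset \<Rightarrow> bool" where
  "rel_fset alpha_p XX YY \<Longrightarrow> alpha_p (RAnd XX) (RAnd YY)"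
| "alpha_p X Y \<Longrightarrow> alpha_p (RNeg X) (RNeg Y)"
| "level a = level b \<Longrightarrow>
   cofin (level a) (\<lambda>c. alpha_p (map_rpred (swp c a) X) (map_rpred (swp c b) Y)) \<Longrightarrow>
   alpha_p (RAll a X) (RAll b Y)"
| "alpha_s x y \<Longrightarrow> alpha_p (RMem x a) (RMem y a)"
| "alpha_s (RAtm a) (RAtm a)"
| "level a = level b \<Longrightarrow>
   cofin (level a) (\<lambda>c. alpha_p (map_rpred (swp c a) X) (map_rpred (swp c b) Y)) \<Longrightarrow>
   alpha_s (RAbs a X) (RAbs b Y)"

inductive_simps wf_simps [simp]:
  "wf_rpred (RAnd XX)" "wf_rpred (RNeg X)" "wf_rpred (RAll a X)" "wf_rpred (RMem x a)"
  "wf_rset (RAtm a)" "wf_rset (RAbs a X)"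

inductive_simps alpha_simps:
  "alpha_p (RAnd XX) Y" "alpha_p (RNeg X) Y" "alpha_p (RAll a X) Y" "alpha_p (RMem x a) Y"
  "alpha_s (RAtm a) y" "alpha_s (RAbs a X) y"

inductive_simps alpha_simps2 [simp]:
  "alpha_p (RAnd XX) (RAnd YY)" "alpha_p (RNeg X) (RNeg X')" "alpha_p (RAll a X) (RAll b Y)"
  "alpha_p (RMem x a) (RMem y b)"
  "alpha_s (RAtm a) (RAtm b)" "alpha_s (RAbs a X) (RAbs b Y)"
  "alpha_p (RAnd XX) (RNeg X')" "alpha_p (RAnd XX) (RAll b Y)" "alpha_p (RAnd XX) (RMem y b)"
  "alpha_p (RNeg X) (RAll b Y)" "alpha_p (RNeg X) (RMem y b)" "alpha_p (RAll a X) (RMem y b)"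
  "alpha_s (RAtm a) (RAbs b Y)"

definition lperm :: "('a::atoms \<Rightarrow> 'a) \<Rightarrow> bool" where
  "lperm \<pi> \<longleftrightarrow> bij \<pi> \<and> (\<forall>a. level (\<pi> a) = level a)"

lemma lperm_level [simp]: "lperm \<pi> \<Longrightarrow> level (\<pi> a) = level a" by (simp add: lperm_def)
lemma lperm_inj: "lperm \<pi> \<Longrightarrow> \<pi> a = \<pi> b \<longleftrightarrow> a = b" by (metis lperm_def bij_def injD)

lemma swp_level [simp]: "level (swp a b c) = level c"
  by (auto simp: swp_def Transposition.transpose_def)

lemma lperm_swp [simp]: "lperm (swp a b)"
  by (auto simp: lperm_def) (auto simp: swp_def)

lemma swp_swp [simp]: "swp a b (swp a b c) = c"
  by (auto simp: swp_def)

lemma swp_comp_swp [simp]: "swp a b \<circ> swp a b = id"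
  by auto

lemma swp_simps: "level a = level b \<Longrightarrow> swp a b c = (if c = a then b else if c = b then a else c)"
  by (auto simp: swp_def Transposition.transpose_def)

lemma lperm_swp_comp: "lperm \<pi> \<Longrightarrow> \<pi> \<circ> swp a b = swp (\<pi> a) (\<pi> b) \<circ> \<pi>"
  by (auto simp: fun_eq_iff swp_def Transposition.transpose_def lperm_inj)

lemma lperm_comp: "lperm \<pi> \<Longrightarrow> lperm \<rho> \<Longrightarrow> lperm (\<pi> \<circ> \<rho>)"
  by (auto simp: lperm_def bij_comp)

lemma lperm_id [simp]: "lperm id" by (simp add: lperm_def)

lemma cofin_lperm:
  assumes "lperm \<pi>" "cofin i P" "\<And>c. level c = i \<Longrightarrow> P c \<Longrightarrow> Q (\<pi> c)"
  shows "cofin i Q"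
proof -
  have "c \<in> \<pi> ` {a \<in> \<A> i. \<not> P a}" if "level c = i" "\<not> Q c" for c
  proof -
    obtain d where "c = \<pi> d" using assms(1) unfolding lperm_def bij_def by (metis surjD)
    then show ?thesis using assms that by auto
  qed
  then have "{c \<in> \<A> i. \<not> Q c} \<subseteq> \<pi> ` {a \<in> \<A> i. \<not> P a}" by auto
  then show ?thesis using assms(2) unfolding cofin_def by (meson finite_imageI finite_subset)
qed

primrec fv_p :: "'a rpred \<Rightarrow> 'a set" and fv_s :: "'a rset \<Rightarrow> 'a set" where
  "fv_p (RAnd XX) = \<Union> (fset (fv_p |`| XX))"
| "fv_p (RNeg X) = fv_p X"
| "fv_p (RAll a X) = fv_p X - {a}"
| "fv_p (RMem x a) = insert a (fv_s x)"
| "fv_s (RAtm a) = {a}"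
| "fv_s (RAbs a X) = fv_p X - {a}"

primrec depth_p :: "'a rpred \<Rightarrow> nat" and depth_s :: "'a rset \<Rightarrow> nat" where
  "depth_p (RAnd XX) = Suc (Max (insert 0 (fset (depth_p |`| XX))))"
| "depth_p (RNeg X) = Suc (depth_p X)"
| "depth_p (RAll a X) = Suc (depth_p X)"
| "depth_p (RMem x a) = Suc (depth_s x)"
| "depth_s (RAtm a) = 0"
| "depth_s (RAbs a X) = Suc (depth_p X)"

lemma finite_fv [simp]: "finite (fv_p X)" "finite (fv_s x)"
  for X :: "'a rpred" and x :: "'a rset"
  by (induction X and x) auto

lemma fv_map: 
  "lperm \<pi> \<Longrightarrow> fv_p (map_rpred \<pi> X) = \<pi> ` fv_p X" "lperm \<pi> \<Longrightarrow> fv_s (map_rset \<pi> x) = \<pi> ` fv_s x"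
  by (induction X and x) (auto simp: lperm_inj)

lemma depth_map [simp]: 
  "depth_p (map_rpred \<pi> X) = depth_p X" "depth_s (map_rset \<pi> x) = depth_s x"
   apply (induction X and x)
       apply (auto simp: image_image cong: image_cong)
  done

lemma rset_level_map [simp]: "lperm \<pi> \<Longrightarrow> rset_level (map_rset \<pi> x) = rset_level x"
  by (cases x) auto

lemma wf_map:
  "wf_rpred X \<Longrightarrow> lperm \<pi> \<Longrightarrow> wf_rpred (map_rpred \<pi> X)"
  "wf_rset x \<Longrightarrow> lperm \<pi> \<Longrightarrow> wf_rset (map_rset \<pi> x)"
  by (induction rule: wf_rpred_wf_rset.inducts) auto

lemma alpha_agree:
  "lperm \<pi> \<Longrightarrow> lperm \<rho> \<Longrightarrow> (\<And>a. a \<in> fv_p X \<Longrightarrow> \<pi> a = \<rho> a) \<Longrightarrow> alpha_p (map_rpred \<pi> X) (map_rpred \<rho> X)"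
  "lperm \<pi> \<Longrightarrow> lperm \<rho> \<Longrightarrow> (\<And>a. a \<in> fv_s x \<Longrightarrow> \<pi> a = \<rho> a) \<Longrightarrow> alpha_s (map_rset \<pi> x) (map_rset \<rho> x)"
proof (induction X and x arbitrary: \<pi> \<rho> and \<pi> \<rho>)
  case (RAnd XX)
  have "alpha_p (map_rpred \<pi> X) (map_rpred \<rho> X)" if "X |\<in>| XX" for X
    using RAnd.prems that by (intro RAnd.IH) auto
  then show ?case by (auto simp: fset.rel_map intro!: fset.rel_refl_strong)
next
  case (RAll a X)
  have "cofin (level a) (\<lambda>c. alpha_p (map_rpred (swp c (\<pi> a) \<circ> \<pi>) X) (map_rpred (swp c (\<rho> a) \<circ> \<rho>) X))"
  proof (rule cofin_mono[OF cofin_notin[of "\<pi> ` fv_p X \<union> \<rho> ` fv_p X"]])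
    fix c assume c: "level c = level a" "c \<notin> \<pi> ` fv_p X \<union> \<rho> ` fv_p X"
    have "(swp c (\<pi> a) \<circ> \<pi>) b = (swp c (\<rho> a) \<circ> \<rho>) b" if "b \<in> fv_p X" for b
    proof (cases "b = a")
      case False
      then have "\<pi> b = \<rho> b" using that RAll.prems by auto
      moreover have "\<pi> b \<noteq> \<pi> a" "\<rho> b \<noteq> \<rho> a"
        using False lperm_inj[OF RAll.prems(1)] lperm_inj[OF RAll.prems(2)] by auto
      moreover have "\<pi> b \<noteq> c" using that c by auto
      ultimately show ?thesis using c RAll.prems by (simp add: swp_simps)
    qed (use c RAll.prems in \<open>simp add: swp_simps\<close>)
    then show "alpha_p (map_rpred (swp c (\<pi> a) \<circ> \<pi>) X) (map_rpred (swp c (\<rho> a) \<circ> \<rho>) X)"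
      using RAll.prems by (intro RAll.IH lperm_comp) auto
  qed simp
  then show ?case using RAll.prems by (simp add: rpred.map_comp)
next
  case (RAbs a X)
  have "cofin (level a) (\<lambda>c. alpha_p (map_rpred (swp c (\<pi> a) \<circ> \<pi>) X) (map_rpred (swp c (\<rho> a) \<circ> \<rho>) X))"
  proof (rule cofin_mono[OF cofin_notin[of "\<pi> ` fv_p X \<union> \<rho> ` fv_p X"]])
    fix c assume c: "level c = level a" "c \<notin> \<pi> ` fv_p X \<union> \<rho> ` fv_p X"
    have "(swp c (\<pi> a) \<circ> \<pi>) b = (swp c (\<rho> a) \<circ> \<rho>) b" if "b \<in> fv_p X" for b
    proof (cases "b = a")
      case False
      then have "\<pi> b = \<rho> b" using that RAbs.prems by auto
      moreover have "\<pi> b \<noteq> \<pi> a" "\<rho> b \<noteq> \<rho> a"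
        using False lperm_inj[OF RAbs.prems(1)] lperm_inj[OF RAbs.prems(2)] by auto
      moreover have "\<pi> b \<noteq> c" using that c by auto
      ultimately show ?thesis using c RAbs.prems by (simp add: swp_simps)
    qed (use c RAbs.prems in \<open>simp add: swp_simps\<close>)
    then show "alpha_p (map_rpred (swp c (\<pi> a) \<circ> \<pi>) X) (map_rpred (swp c (\<rho> a) \<circ> \<rho>) X)"
      using RAbs.prems by (intro RAbs.IH lperm_comp) auto
  qed simp
  then show ?case using RAbs.prems by (simp add: rpred.map_comp)
qed auto

lemma alpha_refl: "alpha_p X X" "alpha_s x x"
  using alpha_agree[of id id] by (simp_all add: rpred.map_id rset.map_id)

lemma alpha_sym:
  fixes X Y :: "'a::atoms rpred" and x y :: "'a rset"
  shows "alpha_p X Y \<Longrightarrow> alpha_p Y X" and "alpha_s x y \<Longrightarrow> alpha_s y x"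
proof (induction rule: alpha_p_alpha_s.inducts)
  case (1 XX YY)
  then have "rel_fset (alpha_p\<inverse>\<inverse>) XX YY" by (auto elim: fset.rel_mono_strong)
  then show ?case by (simp add: fset.rel_flip)
next
  case (3 a b X Y)
  show ?case using cofin_mono[OF 3(2)] 3(1) by simp
next
  case (6 a b X Y)
  show ?case using cofin_mono[OF 6(2)] 6(1) by simp
qed auto

lemma alpha_trans:
  fixes X Y Z :: "'a::atoms rpred" and x y z :: "'a rset"
  shows "alpha_p X Y \<Longrightarrow> alpha_p Y Z \<Longrightarrow> alpha_p X Z" "alpha_s x y \<Longrightarrow> alpha_s y z \<Longrightarrow> alpha_s x z"
proof (induction arbitrary: Z and z rule: alpha_p_alpha_s.inducts)
  case (1 XX YY)
  then obtain ZZ where ZZ: "Z = RAnd ZZ" "rel_fset alpha_p YY ZZ" by (auto simp: alpha_simps)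
  have "rel_fset (\<lambda>X Y. \<forall>Z. alpha_p Y Z \<longrightarrow> alpha_p X Z) XX YY"
    using 1 by (auto elim: fset.rel_mono_strong)
  then have "rel_fset ((\<lambda>X Y. \<forall>Z. alpha_p Y Z \<longrightarrow> alpha_p X Z) OO alpha_p) XX ZZ"
    using ZZ(2) unfolding fset.rel_compp by blast
  then show ?case using ZZ by (auto elim!: fset.rel_mono_strong)
next
  case (3 a b X Y)
  then obtain d W where Z: "Z = RAll d W" "level b = level d" 
    "cofin (level b) (\<lambda>c. alpha_p (map_rpred (swp c b) Y) (map_rpred (swp c d) W))"
    by (auto simp: alpha_simps)
  have "cofin (level a) (\<lambda>c. alpha_p (map_rpred (swp c a) X) (map_rpred (swp c d) W))"
    using cofin_conj[OF 3(2) Z(3)[folded 3(1)]] by (rule cofin_mono) auto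
  then show ?case using Z 3 by simp
next
  case (6 a b X Y)
  then obtain d W where Z: "z = RAbs d W" "level b = level d" 
    "cofin (level b) (\<lambda>c. alpha_p (map_rpred (swp c b) Y) (map_rpred (swp c d) W))"
    by (auto simp: alpha_simps)
  have "cofin (level a) (\<lambda>c. alpha_p (map_rpred (swp c a) X) (map_rpred (swp c d) W))"
    using cofin_conj[OF 6(2) Z(3)[folded 6(1)]] by (rule cofin_mono) auto
  then show ?case using Z 6 by simp
qed (auto simp: alpha_simps)

lemma alpha_map:
  "alpha_p X Y \<Longrightarrow> lperm \<pi> \<Longrightarrow> alpha_p (map_rpred \<pi> X) (map_rpred \<pi> Y)"
  "alpha_s x y \<Longrightarrow> lperm \<pi> \<Longrightarrow> alpha_s (map_rset \<pi> x) (map_rset \<pi> y)"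
proof (induction rule: alpha_p_alpha_s.inducts)
  case (1 XX YY)
  then show ?case by (auto simp: fset.rel_map elim: fset.rel_mono_strong)
next
  case (3 a b X Y)
  have "cofin (level a) (\<lambda>c. alpha_p (map_rpred (swp c (\<pi> a)) (map_rpred \<pi> X))
      (map_rpred (swp c (\<pi> b)) (map_rpred \<pi> Y)))"
    by (rule cofin_lperm[OF 3(3) 3(2)]) (use 3 in \<open>auto simp: rpred.map_comp lperm_swp_comp\<close>)
  then show ?case using 3 by simp
next
  case (6 a b X Y)
  have "cofin (level a) (\<lambda>c. alpha_p (map_rpred (swp c (\<pi> a)) (map_rpred \<pi> X))
      (map_rpred (swp c (\<pi> b)) (map_rpred \<pi> Y)))"
    by (rule cofin_lperm[OF 6(3) 6(2)]) (use 6 in \<open>auto simp: rpred.map_comp lperm_swp_comp\<close>)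
  then show ?case using 6 by simp
qed auto

lemma alpha_rset_level: "alpha_s x y \<Longrightarrow> rset_level x = rset_level y"
  by (cases x; cases y) (auto simp: alpha_simps)

lemma rel_fset_image_eq: "rel_fset (\<lambda>x y. f x = f y) A B \<Longrightarrow> f |`| A = f |`| B"
  by (simp only: fset.rel_eq[symmetric] fset.rel_map)

lemma fv_bind_swp:
  assumes "level c = level a" "c \<noteq> a" "c \<notin> fv_p X"
  shows "fv_p X - {a} = fv_p (map_rpred (swp c a) X) - {c}"
  using assms by (auto simp: fv_map swp_simps image_iff split: if_splits)

lemma alpha_fv:
  fixes X Y :: "'a::atoms rpred" and x y :: "'a rset"
  shows "alpha_p X Y \<Longrightarrow> fv_p X = fv_p Y" "alpha_s x y \<Longrightarrow> fv_s x = fv_s y"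
proof (induction rule: alpha_p_alpha_s.inducts)
  case (1 XX YY)
  then have "fv_p |`| XX = fv_p |`| YY"
    by (intro rel_fset_image_eq) (auto elim: fset.rel_mono_strong)
  then show ?case by (simp only: fv_p.simps)
next
  case (3 a b X Y)
  obtain c where "level c = level a" "c \<notin> fv_p X \<union> fv_p Y \<union> {a, b}" 
    "fv_p (map_rpred (swp c a) X) = fv_p (map_rpred (swp c b) Y)"
    using cofin_ex[OF cofin_conj[OF cofin_notin[of "fv_p X \<union> fv_p Y \<union> {a, b}"] 3(2)]] by fastforce
  then show ?case using 3(1) fv_bind_swp[of c a X] fv_bind_swp[of c b Y] by simp
next
  case (6 a b X Y)
  obtain c where "level c = level a" "c \<notin> fv_p X \<union> fv_p Y \<union> {a, b}" 
    "fv_p (map_rpred (swp c a) X) = fv_p (map_rpred (swp c b) Y)"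
    using cofin_ex[OF cofin_conj[OF cofin_notin[of "fv_p X \<union> fv_p Y \<union> {a, b}"] 6(2)]] by fastforce
  then show ?case using 6(1) fv_bind_swp[of c a X] fv_bind_swp[of c b Y] by simp
qed auto

lemma alpha_depth:
  fixes X Y :: "'a::atoms rpred" and x y :: "'a rset"
  shows "alpha_p X Y \<Longrightarrow> depth_p X = depth_p Y" "alpha_s x y \<Longrightarrow> depth_s x = depth_s y"
proof (induction rule: alpha_p_alpha_s.inducts)
  case (1 XX YY)
  then have "depth_p |`| XX = depth_p |`| YY"
    by (intro rel_fset_image_eq) (auto elim: fset.rel_mono_strong)
  then show ?case by (simp only: depth_p.simps)
next
  case (3 a b X Y)
  then show ?case using cofin_ex[OF 3(2)] by auto
next
  case (6 a b X Y)
  then show ?case using cofin_ex[OF 6(2)] by auto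
qed auto

lemma levels_map:
  assumes "lperm \<pi>"
  shows "level ` set_rpred (map_rpred \<pi> X) = level ` set_rpred X"
    "level ` set_rset (map_rset \<pi> x) = level ` set_rset x"
  using assms by (auto simp: rpred.set_map rset.set_map image_image)

lemma alpha_levels:
  fixes X Y :: "'a::atoms rpred" and x y :: "'a rset"
  shows "alpha_p X Y \<Longrightarrow> level ` set_rpred X = level ` set_rpred Y"
  "alpha_s x y \<Longrightarrow> level ` set_rset x = level ` set_rset y"
proof (induction rule: alpha_p_alpha_s.inducts)
  case (1 XX YY)
  then have "(\<lambda>X. level ` set_rpred X) |`| XX = (\<lambda>X. level ` set_rpred X) |`| YY"
    by (intro rel_fset_image_eq) (auto elim: fset.rel_mono_strong)
  then have "\<Union> (fset ((\<lambda>X. level ` set_rpred X) |`| XX)) = \<Union> (fset ((\<lambda>X. level ` set_rpred X) |`| YY))"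
    by (simp only:)
  then show ?case by (simp add: image_UN)
next
  case (3 a b X Y)
  then show ?case using cofin_ex[OF 3(2)] by (auto simp: levels_map)
next
  case (6 a b X Y)
  then show ?case using cofin_ex[OF 6(2)] by (auto simp: levels_map)
qed auto

lemma alpha_swp_fresh:
  fixes X :: "'a::atoms rpred" and x :: "'a rset"
  shows "a \<notin> fv_p X \<Longrightarrow> b \<notin> fv_p X \<Longrightarrow> alpha_p (map_rpred (swp a b) X) X"
  "a \<notin> fv_s x \<Longrightarrow> b \<notin> fv_s x \<Longrightarrow> alpha_s (map_rset (swp a b) x) x"
proof -
  have *: "swp a b c = c" if "c \<noteq> a" "c \<noteq> b" for c using that by (auto simp: swp_def)
  have "alpha_p (map_rpred (swp a b) X) (map_rpred id X)" if "a \<notin> fv_p X" "b \<notin> fv_p X"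
    by (rule alpha_agree) (use that in \<open>auto intro!: *\<close>)
  then show "a \<notin> fv_p X \<Longrightarrow> b \<notin> fv_p X \<Longrightarrow> alpha_p (map_rpred (swp a b) X) X"
    by (simp add: rpred.map_id)
  have "alpha_s (map_rset (swp a b) x) (map_rset id x)" if "a \<notin> fv_s x" "b \<notin> fv_s x"
    by (rule alpha_agree) (use that in \<open>auto intro!: *\<close>)
  then show "a \<notin> fv_s x \<Longrightarrow> b \<notin> fv_s x \<Longrightarrow> alpha_s (map_rset (swp a b) x) x"
    by (simp add: rset.map_id)
qed

lemma rel_fset_empty [simp]: "rel_fset R {||} {||}"
  by (simp add: rel_fset_alt_def)

text \<open>The quotients are partial: only terms satisfying the level conditions are in their domain.\<close>

quotient_type (overloaded) 'a ipred = "'a::atoms rpred" / partial: "\<lambda>X Y. wf_rpred X \<and> wf_rpred Y \<and> alpha_p X Y"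
proof (rule part_equivpI)
  show "\<exists>X::'a rpred. wf_rpred X \<and> wf_rpred X \<and> alpha_p X X"
    by (rule exI[of _ "RAnd {||}"]) auto
qed (auto intro!: sympI transpI intro: alpha_sym alpha_trans)

quotient_type (overloaded) 'a iset = "'a::atoms rset" / partial: "\<lambda>x y. wf_rset x \<and> wf_rset y \<and> alpha_s x y"
proof (rule part_equivpI)
  show "\<exists>x::'a rset. wf_rset x \<and> wf_rset x \<and> alpha_s x x"
    by (rule exI[of _ "RAtm undefined"]) auto
qed (auto intro!: sympI transpI intro: alpha_sym alpha_trans)

lemma alpha_map_cofin: "alpha_p X Y \<Longrightarrow> cofin i (\<lambda>c. alpha_p (map_rpred (swp c a) X) (map_rpred (swp c a) Y))"
  by (rule cofin_mono[OF cofin_notin[of "{}"]]) (auto intro: alpha_map)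

lift_definition set_level :: "'a::atoms iset \<Rightarrow> int" is rset_level
  by (auto dest: alpha_rset_level)

lift_definition Conj :: "'a::atoms ipred fset \<Rightarrow> 'a ipred" is RAnd
proof -
  fix XX YY :: "'a rpred fset"
  assume *: "rel_fset (\<lambda>X Y. wf_rpred X \<and> wf_rpred Y \<and> alpha_p X Y) XX YY"
  then have "rel_fset alpha_p XX YY" by (rule fset.rel_mono_strong) auto
  then show "wf_rpred (RAnd XX) \<and> wf_rpred (RAnd YY) \<and> alpha_p (RAnd XX) (RAnd YY)"
    using * by (auto simp: rel_fset_alt_def)
qed

lift_definition Neg :: "'a::atoms ipred \<Rightarrow> 'a ipred" is RNeg
  by auto

lift_definition Forall :: "'a::atoms \<Rightarrow> 'a ipred \<Rightarrow> 'a ipred" is RAll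
  by (auto intro: alpha_map_cofin)

text \<open>\<open>Mem x a\<close> is the internal predicate written with the membership symbol applied to \<open>(x, a)\<close>, for
  \<open>a\<close> of level one above that of \<open>x\<close>. For other arguments it is the dummy value \<open>\<bottom>\<close>, which never
  matters: membership is always used under that level condition.\<close>

lift_definition Mem :: "'a::atoms iset \<Rightarrow> 'a \<Rightarrow> 'a ipred" is
  "\<lambda>x a. if level a = rset_level x + 1 then RMem x a else RNeg (RAnd {||})"
  by (auto dest: alpha_rset_level)

lift_definition Atm :: "'a::atoms \<Rightarrow> 'a iset" is RAtm
  by auto

lift_definition Abs :: "'a::atoms \<Rightarrow> 'a ipred \<Rightarrow> 'a iset" is RAbs
  by (auto intro: alpha_map_cofin)

lift_definition swap_p :: "'a::atoms \<Rightarrow> 'a \<Rightarrow> 'a ipred \<Rightarrow> 'a ipred" is "\<lambda>a b. map_rpred (swp a b)"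
  by (auto intro: wf_map alpha_map)

lift_definition swap_s :: "'a::atoms \<Rightarrow> 'a \<Rightarrow> 'a iset \<Rightarrow> 'a iset" is "\<lambda>a b. map_rset (swp a b)"
  by (auto intro: wf_map alpha_map)

lift_definition free_p :: "'a::atoms ipred \<Rightarrow> 'a set" is fv_p
  by (auto dest: alpha_fv)

lift_definition free_s :: "'a::atoms iset \<Rightarrow> 'a set" is fv_s
  by (auto dest: alpha_fv)

lift_definition dep_p :: "'a::atoms ipred \<Rightarrow> nat" is depth_p
  by (auto dest: alpha_depth)

lift_definition dep_s :: "'a::atoms iset \<Rightarrow> nat" is depth_s
  by (auto dest: alpha_depth)

lift_definition levels_p :: "'a::atoms ipred \<Rightarrow> int set" is "\<lambda>X. level ` set_rpred X"
  by (auto dest: alpha_levels)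

lift_definition levels_s :: "'a::atoms iset \<Rightarrow> int set" is "\<lambda>x. level ` set_rset x"
  by (auto dest: alpha_levels)

lemma set_level_simps [simp]:
  "set_level (Atm a) = level a" "set_level (Abs a X) = level a + 1"
  by (transfer, simp)+

lemma free_simps [simp]:
  "free_p (Conj XX) = \<Union> (free_p ` fset XX)"
  "free_p (Neg X) = free_p X"
  "free_p (Forall a X) = free_p X - {a}"
  "level a = set_level x + 1 \<Longrightarrow> free_p (Mem x a) = insert a (free_s x)"
  "free_s (Atm a) = {a}"
  "free_s (Abs a X) = free_p X - {a}"
  by (transfer, simp)+

lemma finite_free [simp]: "finite (free_p X)" "finite (free_s x)" for X :: "'a::atoms ipred" and x :: "'a iset"
  by (transfer, simp)+

lemma dep_simps:
  "X |\<in>| XX \<Longrightarrow> dep_p X < dep_p (Conj XX)"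
  "dep_p (Neg X) = Suc (dep_p X)"
  "dep_p (Forall a X) = Suc (dep_p X)"
  "level a = set_level x + 1 \<Longrightarrow> dep_p (Mem x a) = Suc (dep_s x)"
  "dep_s (Atm a) = 0"
  "dep_s (Abs a X) = Suc (dep_p X)"
proof -
  show "X |\<in>| XX \<Longrightarrow> dep_p X < dep_p (Conj XX)"
  proof -
    have "dep_p (Conj XX) = Suc (Max (insert 0 (dep_p ` fset XX)))" by (transfer, simp)
    moreover assume "X |\<in>| XX"
    then have "dep_p X \<le> Max (insert 0 (dep_p ` fset XX))" by (intro Max_ge) auto
    ultimately show ?thesis by simp
  qed
qed (transfer, simp)+

lemma levels_simps [simp]:
  "levels_p (Conj XX) = \<Union> (levels_p ` fset XX)"
  "levels_p (Neg X) = levels_p X"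
  "levels_p (Forall a X) = insert (level a) (levels_p X)"
  "level a = set_level x + 1 \<Longrightarrow> levels_p (Mem x a) = insert (level a) (levels_s x)"
  "levels_s (Atm a) = {level a}"
  "levels_s (Abs a X) = insert (level a) (levels_p X)"
  by (transfer, auto)+

lemma wf_rset_alpha_map [simp]: "wf_rset x \<Longrightarrow> wf_rset (map_rset (swp a b) x)"
  and wf_rpred_alpha_map [simp]: "wf_rpred X \<Longrightarrow> wf_rpred (map_rpred (swp a b) X)"
  by (simp_all add: wf_map)

lemma swap_simps [simp]:
  "swap_p a b (Conj XX) = Conj (swap_p a b |`| XX)"
  "swap_p a b (Neg X) = Neg (swap_p a b X)"
  "swap_p a b (Forall c X) = Forall (swp a b c) (swap_p a b X)"
  "swap_p a b (Mem x c) = Mem (swap_s a b x) (swp a b c)"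
  "swap_s a b (Atm c) = Atm (swp a b c)"
  "swap_s a b (Abs c X) = Abs (swp a b c) (swap_p a b X)"
       apply (transfer, auto simp: alpha_refl fset.pred_set intro!: fset.rel_refl_strong)
      apply (transfer, auto simp: alpha_refl intro!: wf_map)
     apply (transfer, auto simp: alpha_refl intro!: wf_map)
    apply (transfer, auto simp: alpha_refl intro!: wf_map)
   apply (transfer, auto simp: alpha_refl intro!: wf_map)
  apply (transfer, auto simp: alpha_refl intro!: wf_map)
  done

lemma swap_level [simp]: "set_level (swap_s a b x) = set_level x"
  by transfer simp

lemma swap_dep [simp]: "dep_p (swap_p a b X) = dep_p X" "dep_s (swap_s a b x) = dep_s x"
  by (transfer, simp)+

lemma swap_levels [simp]: "levels_p (swap_p a b X) = levels_p X" "levels_s (swap_s a b x) = levels_s x"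
  by (transfer, simp add: levels_map)+

lemma free_swap: "free_p (swap_p a b X) = swp a b ` free_p X" "free_s (swap_s a b x) = swp a b ` free_s x"
  by (transfer, simp add: fv_map)+

lemma swap_swap [simp]: "swap_p a b (swap_p a b X) = X" "swap_s a b (swap_s a b x) = x"
  by (transfer, simp add: rpred.map_comp rset.map_comp rpred.map_id rset.map_id alpha_refl)+

lemma swap_swap_eqvt: "swap_p c d (swap_p a b X) = swap_p (swp c d a) (swp c d b) (swap_p c d X)"
proof -
  have "map_rpred (swp c d) (map_rpred (swp a b) Y) =
      map_rpred (swp (swp c d a) (swp c d b)) (map_rpred (swp c d) Y)" for Y
    unfolding rpred.map_comp by (rule arg_cong[OF lperm_swp_comp[OF lperm_swp]])
  then show ?thesis by transfer (simp add: alpha_refl)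
qed

lemma swap_fresh:
  "a \<notin> free_p X \<Longrightarrow> b \<notin> free_p X \<Longrightarrow> swap_p a b X = X"
  "a \<notin> free_s x \<Longrightarrow> b \<notin> free_s x \<Longrightarrow> swap_s a b x = x"
  by (transfer, simp add: alpha_swp_fresh)+

lemma ipred_exhaust:
  obtains XX where "X = Conj XX" | Y where "X = Neg Y" | a Y where "X = Forall a Y"
    | x a where "X = Mem x a" "level a = set_level x + 1"
proof -
  have "(\<exists>XX. X = Conj XX) \<or> (\<exists>Y. X = Neg Y) \<or> (\<exists>a Y. X = Forall a Y) \<or>
     (\<exists>x a. level a = set_level x + 1 \<and> X = Mem x a)"
  proof (transfer, goal_cases)
    case (1 X)
    show ?case
    proof (cases X)
      case (RAnd XX)
      then show ?thesis
        using 1 alpha_refl by (intro disjI1 bexI[of _ XX]) (auto simp: fset.pred_set simp del: alpha_simps2)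
    next
      case (RNeg Y)
      then show ?thesis
        using 1 alpha_refl by (intro disjI2[OF disjI1] bexI[of _ Y]) (auto simp del: alpha_simps2)
    next
      case (RAll a Y)
      then show ?thesis
        using 1 alpha_refl
        by (intro disjI2[OF disjI2[OF disjI1]] exI[of _ a] bexI[of _ Y]) (auto simp del: alpha_simps2)
    next
      case (RMem x a)
      then show ?thesis
        using 1 alpha_refl
        by (intro disjI2[OF disjI2[OF disjI2]] exI[of _ a] bexI[of _ x]) (auto simp del: alpha_simps2)
    qed
  qed
  then consider XX where "X = Conj XX" | Y where "X = Neg Y" | a Y where "X = Forall a Y"
    | x a where "level a = set_level x + 1" "X = Mem x a"
    by (elim disjE exE conjE)
  then show ?thesis
  proof cases
    case 4
    then show ?thesis using that(4) by simp
  qed (fact that)+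
qed

lemma iset_exhaust:
  obtains a where "x = Atm a" | a X where "x = Abs a X"
proof -
  have "(\<exists>a. x = Atm a) \<or> (\<exists>a X. x = Abs a X)"
  proof (transfer, goal_cases)
    case (1 x)
    show ?case
    proof (cases x)
      case (RAtm a)
      then show ?thesis by auto
    next
      case (RAbs a X)
      then show ?thesis
        using 1 alpha_refl by (intro disjI2 exI[of _ a] bexI[of _ X]) (auto simp del: alpha_simps2)
    qed
  qed
  then show ?thesis using that by blast
qed

lemma Conj_inject: "Conj XX = Conj YY \<longleftrightarrow> XX = YY"
proof
  assume "Conj XX = Conj YY"
  then have "abs_ipred (RAnd (rep_ipred |`| XX)) = abs_ipred (RAnd (rep_ipred |`| YY))"
    by (simp add: Conj_def)
  moreover have "wf_rpred (rep_ipred X)" for X :: "'a ipred"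
    using Quotient_rep_reflp[OF Quotient_ipred, of X] by simp
  ultimately have "alpha_p (RAnd (rep_ipred |`| XX)) (RAnd (rep_ipred |`| YY))"
    using Quotient_rel[OF Quotient_ipred, of "RAnd (rep_ipred |`| XX)" "RAnd (rep_ipred |`| YY)"]
    by (auto simp: alpha_refl)
  then have "rel_fset (\<lambda>X Y. alpha_p (rep_ipred X) (rep_ipred Y)) XX YY"
    by (simp add: fset.rel_map)
  then have "rel_fset (=) XX YY"
    by (rule fset.rel_mono_strong)
      (metis Quotient_rel_rep[OF Quotient_ipred] Quotient_rep_reflp[OF Quotient_ipred])
  then show "XX = YY" by (simp add: fset.rel_eq)
qed simp

lemma Neg_inject: "Neg X = Neg Y \<longleftrightarrow> X = Y"
  by transfer simp

lemma Forall_inject: "Forall a X = Forall b Y \<longleftrightarrow>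
    level a = level b \<and> cofin (level a) (\<lambda>c. swap_p c a X = swap_p c b Y)"
  by transfer simp

lemma Mem_inject: "level a = set_level x + 1 \<Longrightarrow> level b = set_level y + 1 \<Longrightarrow>
    Mem x a = Mem y b \<longleftrightarrow> x = y \<and> a = b"
  by transfer auto

lemma Atm_inject: "Atm a = Atm b \<longleftrightarrow> a = b"
  by transfer auto

lemma Abs_inject: "Abs a X = Abs b Y \<longleftrightarrow>
    level a = level b \<and> cofin (level a) (\<lambda>c. swap_p c a X = swap_p c b Y)"
  by transfer simp

lemmas ipred_inject = Conj_inject Neg_inject Forall_inject Mem_inject Atm_inject Abs_inject

lemma ipred_distinct:
  "Conj XX \<noteq> Neg Y" "Conj XX \<noteq> Forall b Y" "level c = set_level x + 1 \<Longrightarrow> Conj XX \<noteq> Mem x c"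
  "Neg X \<noteq> Forall b Y" "level c = set_level x + 1 \<Longrightarrow> Neg X \<noteq> Mem x c"
  "level c = set_level x + 1 \<Longrightarrow> Forall a X \<noteq> Mem x c"
  "Atm a \<noteq> Abs b Y"
  by (transfer, auto)+

lemma New_iff_cofin: "cofin i (\<lambda>a. P a \<longleftrightarrow> Q a) \<Longrightarrow> New i P \<longleftrightarrow> New i Q"
  by (rule New_iff_finite) (simp add: cofin_def)

text \<open>A pair \<open>(a, y)\<close> in \<open>p\<close> stands for the element of the prepoint relating \<open>a\<close> to \<open>y\<close>.\<close>

function valid :: "('a::atoms \<times> 'a iset) set \<Rightarrow> 'a ipred \<Rightarrow> bool" (infix \<open>\<Turnstile>\<close> 50) where
  "p \<Turnstile> Conj XX \<longleftrightarrow> (\<forall>X |\<in>| XX. p \<Turnstile> X)"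
| "p \<Turnstile> Neg X \<longleftrightarrow> \<not> p \<Turnstile> X"
| "p \<Turnstile> Forall a X \<longleftrightarrow> New (level a) (\<lambda>a'. p \<Turnstile> swap_p a' a X)"
| "level a = set_level y + 1 \<Longrightarrow> p \<Turnstile> Mem y a \<longleftrightarrow> (a, y) \<in> p"
proof goal_cases
  case (1 P x)
  then show ?case by (cases x) (rule ipred_exhaust[of "snd x"]; simp)
next
  case (9 p a X p' b Y)
  then have "p = p'" "level a = level b" "cofin (level a) (\<lambda>c. swap_p c a X = swap_p c b Y)"
    by (auto simp: ipred_inject)
  then show ?case by (auto intro!: New_iff_cofin elim: cofin_mono)
qed (auto simp: ipred_inject Conj_inject ipred_distinct ipred_distinct[symmetric])
termination
  by (relation "measure (\<lambda>(p, X). dep_p X)") (auto simp: dep_simps)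

text \<open>Substitution recurses into the substituted set (rule \<open>subst_Mem_Abs\<close>), so it is introduced by its
  graph. The graph is single-valued and, when the levels of \<open>a\<close> and \<open>x\<close> agree, total
  (\<open>subst_unique\<close>, \<open>subst_p_ex\<close>, \<open>subst_s_ex\<close>); the resulting functions satisfy the defining equations
  of substitution (\<open>sub_simps\<close>, \<open>sub_Mem_Atm\<close>, \<open>sub_Mem_Abs\<close>).\<close>

inductive
  subst_p :: "'a::atoms ipred \<Rightarrow> 'a \<Rightarrow> 'a iset \<Rightarrow> 'a ipred \<Rightarrow> bool" and
  subst_s :: "'a::atoms iset \<Rightarrow> 'a \<Rightarrow> 'a iset \<Rightarrow> 'a iset \<Rightarrow> bool" where
  subst_Conj: "(\<And>X. X |\<in>| XX \<Longrightarrow> subst_p X a x (f X)) \<Longrightarrow> subst_p (Conj XX) a x (Conj (f |`| XX))"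
| subst_Neg: "subst_p X a x X' \<Longrightarrow> subst_p (Neg X) a x (Neg X')"
| subst_Forall: "b \<noteq> a \<Longrightarrow> b \<notin> free_s x \<Longrightarrow> subst_p X a x X' \<Longrightarrow>
    subst_p (Forall b X) a x (Forall b X')"
| subst_Mem_Atm: "level a = set_level y + 1 \<Longrightarrow> subst_s y a (Atm n) y' \<Longrightarrow>
    subst_p (Mem y a) a (Atm n) (Mem y' n)"
| subst_Mem_Abs: "level a = set_level y + 1 \<Longrightarrow> subst_s y a (Abs a' X) y' \<Longrightarrow>
    a' \<noteq> a \<Longrightarrow> a' \<notin> free_s y \<Longrightarrow> subst_p X a' y' Z \<Longrightarrow>
    subst_p (Mem y a) a (Abs a' X) Z"
| subst_Mem_other: "level b = set_level y + 1 \<Longrightarrow> b \<noteq> a \<Longrightarrow> subst_s y a x y' \<Longrightarrow>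
    subst_p (Mem y b) a x (Mem y' b)"
| subst_Atm: "subst_s (Atm a) a x x"
| subst_Atm_other: "b \<noteq> a \<Longrightarrow> subst_s (Atm b) a x (Atm b)"
| subst_Abs: "c \<noteq> a \<Longrightarrow> c \<notin> free_s x \<Longrightarrow> subst_p X a x X' \<Longrightarrow>
    subst_s (Abs c X) a x (Abs c X')"

lemma subst_level:
  fixes X X' :: "'a::atoms ipred" and z z' :: "'a iset"
  shows "subst_p X a x X' \<Longrightarrow> True"
    "subst_s z a x z' \<Longrightarrow> level a = set_level x \<Longrightarrow> set_level z' = set_level z"
  by (induction rule: subst_p_subst_s.inducts) auto

lemma subst_free:
  fixes X X' :: "'a::atoms ipred" and z z' :: "'a iset"
  shows "subst_p X a x X' \<Longrightarrow> level a = set_level x \<Longrightarrow> free_p X' \<subseteq> (free_p X - {a}) \<union> free_s x"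
    "subst_s z a x z' \<Longrightarrow> level a = set_level x \<Longrightarrow> free_s z' \<subseteq> (free_s z - {a}) \<union> free_s x"
proof (induction rule: subst_p_subst_s.inducts)
  case (subst_Conj XX a x f)
  then show ?case by fastforce
next
  case (subst_Mem_Atm a y n y')
  then show ?case using subst_level(2)[OF subst_Mem_Atm(2)] by auto
next
  case (subst_Mem_Abs a y a' X y' Z)
  have "set_level y' = set_level y" using subst_level(2)[OF subst_Mem_Abs(2)] subst_Mem_Abs.prems by auto
  then have "free_p Z \<subseteq> free_p X - {a'} \<union> free_s y'"
    using subst_Mem_Abs by auto
  then show ?case using subst_Mem_Abs by auto
next
  case (subst_Mem_other b y a x y')
  then show ?case using subst_level(2)[OF subst_Mem_other(3)] by auto
qed auto

lemma swp_eq_iff [simp]: "swp c d a = swp c d b \<longleftrightarrow> a = b"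
  by (rule lperm_inj) simp

lemma swp_in_image [simp]: "swp c d a \<in> swp c d ` A \<longleftrightarrow> a \<in> A"
  by (auto simp: image_iff)

lemma subst_swap:
  fixes X X' :: "'a::atoms ipred" and z z' :: "'a iset"
  shows "subst_p X a x X' \<Longrightarrow> subst_p (swap_p c d X) (swp c d a) (swap_s c d x) (swap_p c d X')"
    "subst_s z a x z' \<Longrightarrow> subst_s (swap_s c d z) (swp c d a) (swap_s c d x) (swap_s c d z')"
proof (induction rule: subst_p_subst_s.inducts)
  case (subst_Conj XX a x f)
  have "subst_p (Conj (swap_p c d |`| XX)) (swp c d a) (swap_s c d x)
     (Conj ((\<lambda>X. swap_p c d (f (swap_p c d X))) |`| (swap_p c d |`| XX)))"
    by (rule subst_p_subst_s.subst_Conj) (use subst_Conj in auto)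
  then show ?case by (simp add: fset.map_comp comp_def)
qed (auto intro!: subst_p_subst_s.intros simp: free_swap)

lemma swp_other: "b \<noteq> c \<Longrightarrow> b \<noteq> d \<Longrightarrow> swp c d b = b"
  by (auto simp: swp_def)

lemma binder_unique:
  assumes eq: "level b = level c" "cofin (level b) (\<lambda>d. swap_p d b Z = swap_p d c W)"
    and b: "b \<noteq> a" "b \<notin> free_s x" and c: "c \<noteq> a" "c \<notin> free_s x"
    and W: "subst_p W a x W'" and IH: "\<And>Z''. subst_p Z a x Z'' \<Longrightarrow> Z'' = Z'"
  shows "cofin (level b) (\<lambda>d. swap_p d b Z' = swap_p d c W')"
  using cofin_conj[OF eq(2) cofin_notin[of "insert a (free_s x)"]]
proof (rule cofin_mono)
  fix d assume d: "swap_p d b Z = swap_p d c W \<and> d \<notin> insert a (free_s x)"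
  have "subst_p (swap_p d c W) (swp d c a) (swap_s d c x) (swap_p d c W')"
    by (rule subst_swap(1)[OF W])
  moreover have "swp d c a = a" "swp d b a = a" using b c d by (auto intro: swp_other)
  moreover have "swap_s d c x = x" "swap_s d b x = x" using b c d by (auto intro: swap_fresh)
  ultimately have "subst_p (swap_p d b Z) a x (swap_p d c W')" using d by simp
  from subst_swap(1)[OF this, of d b]
  have "subst_p Z a x (swap_p d b (swap_p d c W'))"
    using \<open>swp d b a = a\<close> \<open>swap_s d b x = x\<close> by simp
  from IH[OF this, symmetric] show "swap_p d b Z' = swap_p d c W'" by simp
qed simp

lemmas neqs = ipred_distinct ipred_distinct[symmetric]

lemma subst_Conj_inv:
  assumes "subst_p (Conj XX) a x Z"
  obtains f where "Z = Conj (f |`| XX)" "\<And>X. X |\<in>| XX \<Longrightarrow> subst_p X a x (f X)"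
  using assms by (cases rule: subst_p.cases) (auto simp: Conj_inject neqs)

lemma subst_Neg_inv:
  assumes "subst_p (Neg X) a x Z"
  obtains X' where "Z = Neg X'" "subst_p X a x X'"
  using assms by (cases rule: subst_p.cases) (auto simp: ipred_inject neqs)

lemma subst_Forall_inv:
  assumes "subst_p (Forall b X) a x Z"
  obtains c W W' where "Z = Forall c W'" "c \<noteq> a" "c \<notin> free_s x" "subst_p W a x W'"
    "level b = level c" "cofin (level b) (\<lambda>d. swap_p d b X = swap_p d c W)"
  using assms
proof (cases rule: subst_p.cases)
  case (subst_Forall c W W')
  have "level b = level c" "cofin (level b) (\<lambda>d. swap_p d b X = swap_p d c W)"
    using subst_Forall(1) unfolding Forall_inject by blast+
  then show ?thesis by (rule that[OF subst_Forall(2-5)])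
qed (simp_all add: neqs)

lemma subst_Abs_inv:
  assumes "subst_s (Abs b X) a x z"
  obtains c W W' where "z = Abs c W'" "c \<noteq> a" "c \<notin> free_s x" "subst_p W a x W'"
    "level b = level c" "cofin (level b) (\<lambda>d. swap_p d b X = swap_p d c W)"
  using assms
proof (cases rule: subst_s.cases)
  case (subst_Abs c W W')
  have "level b = level c" "cofin (level b) (\<lambda>d. swap_p d b X = swap_p d c W)"
    using subst_Abs(1) unfolding Abs_inject by blast+
  then show ?thesis by (rule that[OF subst_Abs(2-5)])
qed (simp_all add: neqs)

lemma subst_Mem_other_inv:
  assumes "subst_p (Mem y b) a x Z" "level b = set_level y + 1" "b \<noteq> a"
  obtains y' where "Z = Mem y' b" "subst_s y a x y'"
  using assms(1)
proof (cases rule: subst_p.cases)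
  case (subst_Mem_Atm y0 n y')
  then show ?thesis using Mem_inject[OF assms(2) subst_Mem_Atm(4)] assms(3) by metis
next
  case (subst_Mem_Abs y0 a' X y')
  then show ?thesis using Mem_inject[OF assms(2) subst_Mem_Abs(3)] assms(3) by metis
next
  case (subst_Mem_other b0 y0 y')
  then show ?thesis using that Mem_inject[OF assms(2) subst_Mem_other(3)] by metis
qed (use assms(2) in \<open>simp_all add: neqs\<close>)

lemma subst_Mem_Atm_inv:
  assumes "subst_p (Mem y a) a (Atm n) Z" "level a = set_level y + 1"
  obtains y' where "Z = Mem y' n" "subst_s y a (Atm n) y'"
  using assms(1)
proof (cases rule: subst_p.cases)
  case (subst_Mem_Atm y0 n' y')
  then show ?thesis using that Mem_inject[OF assms(2) subst_Mem_Atm(4)] Atm_inject by metis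
next
  case (subst_Mem_Abs y0 a' X y')
  then show ?thesis using ipred_distinct by metis
next
  case (subst_Mem_other b0 y0 y')
  then show ?thesis using Mem_inject[OF assms(2) subst_Mem_other(3)] by metis
qed (use assms(2) in \<open>simp_all add: neqs\<close>)

lemma subst_Mem_Abs_inv:
  assumes "subst_p (Mem y a) a (Abs b X) Z" "level a = set_level y + 1"
  obtains y' c W where "subst_s y a (Abs b X) y'" "c \<noteq> a" "c \<notin> free_s y" "subst_p W c y' Z"
    "level b = level c" "cofin (level b) (\<lambda>d. swap_p d b X = swap_p d c W)"
  using assms(1)
proof (cases rule: subst_p.cases)
  case (subst_Mem_Atm y0 n y')
  then show ?thesis using ipred_distinct by metis
next
  case (subst_Mem_Abs y0 c W y')
  have "y0 = y" using subst_Mem_Abs(1) Mem_inject[OF assms(2) subst_Mem_Abs(3)] by simp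
  have "level b = level c" "cofin (level b) (\<lambda>d. swap_p d b X = swap_p d c W)"
    using subst_Mem_Abs(2) unfolding Abs_inject by blast+
  then show ?thesis using that subst_Mem_Abs \<open>y0 = y\<close> by simp
next
  case (subst_Mem_other b0 y0 y')
  then show ?thesis using Mem_inject[OF assms(2) subst_Mem_other(3)] by metis
qed (use assms(2) in \<open>simp_all add: neqs\<close>)

lemma subst_Atm_inv:
  assumes "subst_s (Atm b) a x z" shows "z = (if b = a then x else Atm b)"
  using assms by (cases rule: subst_s.cases) (auto simp: ipred_inject neqs)

lemma subst_unique:
  fixes X X' X'' :: "'a::atoms ipred" and z z' z'' :: "'a iset"
  shows "subst_p X a x X' \<Longrightarrow> level a = set_level x \<Longrightarrow> subst_p X a x X'' \<Longrightarrow> X'' = X'"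
    "subst_s z a x z' \<Longrightarrow> level a = set_level x \<Longrightarrow> subst_s z a x z'' \<Longrightarrow> z'' = z'"
proof (induction arbitrary: X'' and z'' rule: subst_p_subst_s.inducts)
  case (subst_Conj XX a x f)
  from subst_Conj.prems(2) obtain g where g: "X'' = Conj (g |`| XX)" "\<And>X. X |\<in>| XX \<Longrightarrow> subst_p X a x (g X)"
    by (rule subst_Conj_inv) (rule that)
  have "g |`| XX = f |`| XX" using subst_Conj.IH subst_Conj.prems(1) g(2) by (auto intro!: fimage_cong)
  then show ?case using g by simp
next
  case (subst_Neg X a x X')
  then show ?case by (metis subst_Neg_inv)
next
  case (subst_Forall b a x X X')
  from subst_Forall.prems(2) obtain c W W' where W: "X'' = Forall c W'" "c \<noteq> a" "c \<notin> free_s x" "subst_p W a x W'"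
    "level b = level c" "cofin (level b) (\<lambda>d. swap_p d b X = swap_p d c W)"
    by (rule subst_Forall_inv)
  have "cofin (level b) (\<lambda>d. swap_p d b X' = swap_p d c W')"
    using subst_Forall.IH subst_Forall.prems(1) subst_Forall.hyps
    by (intro binder_unique[OF W(5,6) _ _ W(2,3,4)]) auto
  then have "Forall b X' = Forall c W'" unfolding Forall_inject using W(5) by (rule conjI[rotated])
  then show ?case using W(1) by (rule trans[OF _ sym, THEN sym])
next
  case (subst_Mem_Atm a y n y')
  from subst_Mem_Atm.prems(2) subst_Mem_Atm(1) obtain w where "X'' = Mem w n" "subst_s y a (Atm n) w"
    by (rule subst_Mem_Atm_inv)
  then show ?case using subst_Mem_Atm by simp
next
  case (subst_Mem_Abs a y a' X y' Z)
  from subst_Mem_Abs.prems(2) subst_Mem_Abs(1) obtain w c W where w: "subst_s y a (Abs a' X) w" 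
    "c \<noteq> a" "c \<notin> free_s y" "subst_p W c w X''"
    "level a' = level c" "cofin (level a') (\<lambda>d. swap_p d a' X = swap_p d c W)"
    by (rule subst_Mem_Abs_inv)
  have [simp]: "w = y'" using subst_Mem_Abs w by blast
  have lev: "set_level y' = set_level y" "level a' = set_level y'"
    using subst_level(2)[OF subst_Mem_Abs.hyps(2)] subst_Mem_Abs.hyps(1) subst_Mem_Abs.prems(1) by simp_all
  have Abs_eq: "Abs a' X = Abs c W" unfolding Abs_inject using w(5,6) by (rule conjI)
  have fr: "free_s y' \<subseteq> free_s y \<union> free_s (Abs a' X)"
    using subst_free(2)[OF subst_Mem_Abs.hyps(2)] subst_Mem_Abs.prems(1) by blast
  have "a' \<notin> free_s y'" using fr subst_Mem_Abs.hyps(4) by auto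
  have "c \<notin> free_s y'" using fr w(3) unfolding Abs_eq by auto
  let ?F = "free_s y' \<union> free_p Z \<union> free_p X'' \<union> free_p X \<union> free_p W"
  obtain d where d: "level d = level a'" "d \<notin> ?F" "swap_p d a' X = swap_p d c W"
    using cofin_ex[OF cofin_conj[OF w(6) cofin_notin[of ?F]]] by force
  have fZ: "free_p Z \<subseteq> free_p X - {a'} \<union> free_s y'" using subst_free(1)[OF subst_Mem_Abs.hyps(5)] lev by simp
  have fX'': "free_p X'' \<subseteq> free_p W - {c} \<union> free_s y'" using subst_free(1)[OF w(4)] lev w(5) by simp
  have "subst_p (swap_p d c W) d y' X''"
  proof -
    have "c \<notin> free_p X''" using fX'' \<open>c \<notin> free_s y'\<close> by auto
    then have "swap_p d c X'' = X''" "swap_s d c y' = y'" "swp d c c = d"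
      using d(1,2) w(5) \<open>c \<notin> free_s y'\<close> by (simp_all add: swap_fresh swp_simps)
    then show ?thesis using subst_swap(1)[OF w(4), of d c] by simp
  qed
  then have "subst_p (swap_p d a' X) d y' X''" using d by simp
  from subst_swap(1)[OF this, of d a']
  have "subst_p X a' y' (swap_p d a' X'')"
    using d(1,2) \<open>a' \<notin> free_s y'\<close> by (simp add: swap_fresh swp_simps d(3)[symmetric])
  then have Z: "swap_p d a' X'' = Z" using subst_Mem_Abs.IH(2) lev(2) by blast
  then have "X'' = swap_p d a' Z" using swap_swap(1)[of d a' X''] by simp
  moreover have "a' \<notin> free_p Z" using fZ \<open>a' \<notin> free_s y'\<close> by auto
  ultimately show ?case using d by (simp add: swap_fresh)
next
  case (subst_Mem_other b y a x y')
  from subst_Mem_other.prems(2) subst_Mem_other(1,2) obtain w where "X'' = Mem w b" "subst_s y a x w"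
    by (rule subst_Mem_other_inv)
  then show ?case using subst_Mem_other by simp
next
  case (subst_Abs c a x X X')
  from subst_Abs.prems(2) obtain d W W' where W: "z'' = Abs d W'" "d \<noteq> a" "d \<notin> free_s x" "subst_p W a x W'"
    "level c = level d" "cofin (level c) (\<lambda>e. swap_p e c X = swap_p e d W)"
    by (rule subst_Abs_inv)
  have "cofin (level c) (\<lambda>e. swap_p e c X' = swap_p e d W')"
    using subst_Abs.IH subst_Abs.prems(1) subst_Abs.hyps
    by (intro binder_unique[OF W(5,6) _ _ W(2,3,4)]) auto
  then have "Abs c X' = Abs d W'" unfolding Abs_inject using W(5) by (rule conjI[rotated])
  then show ?case using W(1) by (rule trans[OF _ sym, THEN sym])
qed (auto dest: subst_Atm_inv)


lemma Forall_rename: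
  fixes F :: "'a::atoms set"
  assumes "finite F"
  obtains d where "d \<notin> F" "level d = level b" "Forall b X = Forall d (swap_p d b X)"
    "Abs b X = Abs d (swap_p d b X)"
proof -
  obtain d where d: "level d = level b" "d \<notin> F" "d \<notin> free_p X \<union> {b}"
    using cofin_ex[OF cofin_notin[of "F \<union> (free_p X \<union> {b})" "level b"]] assms by auto
  have "cofin (level b) (\<lambda>c. swap_p c b X = swap_p c d (swap_p d b X))"
  proof (rule cofin_mono[OF cofin_notin[of "free_p X \<union> {b, d}"]])
    fix c assume c: "level c = level b" "c \<notin> free_p X \<union> {b, d}"
    have "swap_p c b X = swap_p c d (swap_p d b X)"
    proof -
      have "swap_p c d (swap_p d b X) = swap_p (swp c d d) (swp c d b) (swap_p c d X)"
        by (rule swap_swap_eqvt)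
      moreover have "swp c d d = c" "swp c d b = b" using c d by (auto simp: swp_simps)
      moreover have "swap_p c d X = X" using c d by (auto intro: swap_fresh)
      ultimately show ?thesis by simp
    qed
    then show "swap_p c b X = swap_p c d (swap_p d b X)" .
  qed simp
  then have "Forall b X = Forall d (swap_p d b X)" "Abs b X = Abs d (swap_p d b X)"
    unfolding Forall_inject Abs_inject using d(1) by simp_all
  then show ?thesis using that d by blast
qed

definition lb_p :: "int \<Rightarrow> 'a::atoms ipred \<Rightarrow> bool" where
  "lb_p m X \<longleftrightarrow> (\<forall>l \<in> levels_p X. m \<le> l)"

definition lb_s :: "int \<Rightarrow> 'a::atoms iset \<Rightarrow> bool" where
  "lb_s m x \<longleftrightarrow> (\<forall>l \<in> levels_s x. m \<le> l)"

lemma lb_simps [simp]: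
  "lb_p m (Conj XX) \<longleftrightarrow> (\<forall>X |\<in>| XX. lb_p m X)"
  "lb_p m (Neg X) \<longleftrightarrow> lb_p m X"
  "lb_p m (Forall a X) \<longleftrightarrow> m \<le> level a \<and> lb_p m X"
  "level a = set_level x + 1 \<Longrightarrow> lb_p m (Mem x a) \<longleftrightarrow> m \<le> level a \<and> lb_s m x"
  "lb_s m (Atm a) \<longleftrightarrow> m \<le> level a"
  "lb_s m (Abs a X) \<longleftrightarrow> m \<le> level a \<and> lb_p m X"
  "lb_p m (swap_p b c X) \<longleftrightarrow> lb_p m X"
  by (auto simp: lb_p_def lb_s_def)

definition subst_ok :: "int \<Rightarrow> nat \<Rightarrow> 'a::atoms \<Rightarrow> 'a iset \<Rightarrow> bool" where
  "subst_ok m n a x \<longleftrightarrow>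
    (\<forall>X. dep_p X < n \<longrightarrow> lb_p m X \<longrightarrow> (\<exists>X'. subst_p X a x X' \<and> lb_p m X')) \<and>
    (\<forall>z. dep_s z < n \<longrightarrow> lb_s m z \<longrightarrow> (\<exists>z'. subst_s z a x z' \<and> lb_s m z'))"

lemma subst_ok_step:
  fixes a :: "'a::atoms"
  assumes IH: "subst_ok m n a x"
    and lev: "level a = set_level x" and lbx: "lb_s m x"
    and hered: "\<And>(b::'a) w n. level b = level a - 1 \<Longrightarrow> level b = set_level w \<Longrightarrow> m \<le> level a \<Longrightarrow> lb_s m w \<Longrightarrow> subst_ok m n b w"
  shows "subst_ok m (Suc n) a x"
proof -
  have IHp: "\<exists>X'. subst_p X a x X' \<and> lb_p m X'" if "dep_p X < n" "lb_p m X" for X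
    using IH that unfolding subst_ok_def by blast
  have IHs: "\<exists>z'. subst_s z a x z' \<and> lb_s m z'" if "dep_s z < n" "lb_s m z" for z
    using IH that unfolding subst_ok_def by blast
  have "\<exists>X'. subst_p X a x X' \<and> lb_p m X'" if dep: "dep_p X < Suc n" and lb: "lb_p m X" for X
  proof (rule ipred_exhaust[of X])
    fix XX assume X: "X = Conj XX"
    have "\<forall>Y \<in> fset XX. \<exists>Y'. subst_p Y a x Y' \<and> lb_p m Y'"
    proof
      fix Y assume Y: "Y |\<in>| XX"
      from dep_simps(1)[OF Y] dep X have "dep_p Y < n" by simp
      then show "\<exists>Y'. subst_p Y a x Y' \<and> lb_p m Y'" using IHp lb X Y by simp
    qed
    from bchoice[OF this] obtain f where f: "\<And>Y. Y |\<in>| XX \<Longrightarrow> subst_p Y a x (f Y) \<and> lb_p m (f Y)"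
      by auto
    have "subst_p X a x (Conj (f |`| XX))" unfolding X by (rule subst_Conj) (use f in blast)
    moreover have "lb_p m (Conj (f |`| XX))" using f by auto
    ultimately show ?thesis by blast
  next
    fix Y assume X: "X = Neg Y"
    with IHp[of Y] dep lb obtain Y' where "subst_p Y a x Y'" "lb_p m Y'" by (auto simp: dep_simps)
    then show ?thesis unfolding X using subst_Neg[of Y a x Y'] by (intro exI[of _ "Neg Y'"]) simp
  next
    fix b Y assume X: "X = Forall b Y"
    obtain d where d: "d \<notin> insert a (free_s x)" "Forall b Y = Forall d (swap_p d b Y)"
      by (rule Forall_rename[of "insert a (free_s x)" b Y]) auto
    then have X': "X = Forall d (swap_p d b Y)" using X by simp
    with IHp[of "swap_p d b Y"] dep lb obtain Y' where "subst_p (swap_p d b Y) a x Y'" "lb_p m Y'"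
      by (auto simp: dep_simps)
    then show ?thesis
      unfolding X' using subst_Forall[of d a x _ Y'] d lb X' by (intro exI[of _ "Forall d Y'"]) auto
  next
    fix y b assume X: "X = Mem y b" and b: "level b = set_level y + 1"
    with IHs[of y] dep lb obtain y' where y': "subst_s y a x y'" "lb_s m y'"
      by (auto simp: dep_simps)
    have [simp]: "set_level y' = set_level y" by (rule subst_level(2)[OF y'(1) lev])
    show ?thesis
    proof (cases "b = a")
      case False
      then show ?thesis
        unfolding X using subst_Mem_other[OF b False y'(1)] y'(2) b lb X
        by (intro exI[of _ "Mem y' b"]) simp
    next
      case True
      show ?thesis
      proof (rule iset_exhaust[of x])
        fix c assume x: "x = Atm c"
        show ?thesis
          unfolding X True using subst_Mem_Atm[of a y c y'] y' b True lev lbx x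
          by (intro exI[of _ "Mem y' c"]) simp
      next
        fix c Y assume x: "x = Abs c Y"
        obtain d where d: "d \<notin> insert a (free_s y)" "level d = level c" "Abs c Y = Abs d (swap_p d c Y)"
          by (rule Forall_rename[of "insert a (free_s y)" c Y]) auto
        have "subst_ok m (Suc (dep_p (swap_p d c Y))) d y'"
          by (rule hered) (use d lev lb lbx x X True y' b in auto)
        moreover have "lb_p m (swap_p d c Y)" using lbx x by simp
        ultimately obtain Z where "subst_p (swap_p d c Y) d y' Z" "lb_p m Z"
          unfolding subst_ok_def by blast
        moreover from this have "subst_p X a x Z"
          unfolding X True x d(3)
          by (intro subst_Mem_Abs[of _ _ _ _ y']) (use b True y' d x in auto)
        ultimately show ?thesis by blast
      qed
    qed
  qed
  moreover have "\<exists>z'. subst_s z a x z' \<and> lb_s m z'" if dep: "dep_s z < Suc n" and lb: "lb_s m z" for z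
  proof (rule iset_exhaust[of z])
    fix b assume "z = Atm b"
    then show ?thesis using subst_Atm[of a x] subst_Atm_other[of b a x] lb lbx by (cases "b = a") auto
  next
    fix b Y assume z: "z = Abs b Y"
    obtain d where d: "d \<notin> insert a (free_s x)" "Abs b Y = Abs d (swap_p d b Y)"
      by (rule Forall_rename[of "insert a (free_s x)" b Y]) auto
    then have z': "z = Abs d (swap_p d b Y)" using z by simp
    with IHp[of "swap_p d b Y"] dep lb obtain Y' where "subst_p (swap_p d b Y) a x Y'" "lb_p m Y'"
      by (auto simp: dep_simps)
    then show ?thesis
      unfolding z' using subst_Abs[of d a x _ Y'] d lb z' by (intro exI[of _ "Abs d Y'"]) auto
  qed
  ultimately show ?thesis unfolding subst_ok_def by blast
qed

lemma subst_ok: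
  fixes a :: "'a::atoms"
  shows "level a = set_level x \<Longrightarrow> level a < m + int k \<Longrightarrow> lb_s m x \<Longrightarrow> subst_ok m n a x"
proof (induction k arbitrary: a x n)
  case 0
  show ?case
  proof (induction n)
    case 0
    show ?case by (simp add: subst_ok_def)
  next
    case (Suc n)
    show ?case by (rule subst_ok_step[OF Suc]) (use 0 in auto)
  qed
next
  case (Suc k)
  note outer_IH = Suc.IH and prems = Suc.prems
  show ?case
  proof (induction n)
    case 0
    show ?case by (simp add: subst_ok_def)
  next
    case (Suc n)
    show ?case
    proof (rule subst_ok_step[OF Suc])
      fix b :: 'a and w :: "'a iset" and n
      assume "level b = level a - 1" "level b = set_level w" "lb_s m w"
      then show "subst_ok m n b w" using prems(2) by (intro outer_IH) auto
    qed (use prems in auto)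
  qed
qed

lemma finite_levels: "finite (levels_p X)" "finite (levels_s x)" for X :: "'a::atoms ipred" and x :: "'a iset"
proof -
  have fin: "finite (set_rpred X)" "finite (set_rset x)" for X :: "'b rpred" and x :: "'b rset"
    by (induction X and x) auto
  show "finite (levels_p X)" "finite (levels_s x)"
    by (transfer, simp add: fin)+
qed

lemma subst_ok_ex:
  fixes a :: "'a::atoms"
  assumes "level a = set_level x" "finite L"
  shows "\<exists>m. (\<forall>l \<in> L. m \<le> l) \<and> subst_ok m n a x"
proof -
  define m where "m = Min (insert (level a) (L \<union> levels_s x))"
  have *: "m \<le> l" if "l \<in> insert (level a) (L \<union> levels_s x)" for l
    unfolding m_def using that assms finite_levels(2)[of x] by (intro Min_le) auto
  have "subst_ok m n a x"
    by (rule subst_ok[where k="Suc (nat (level a - m))"]) (use assms * in \<open>auto simp: lb_s_def\<close>)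
  then show ?thesis using * by auto
qed

lemma subst_p_ex:
  assumes "level a = set_level x" shows "\<exists>Y. subst_p X a x Y"
  using subst_ok_ex[OF assms finite_levels(1)[of X], of "Suc (dep_p X)"]
  unfolding subst_ok_def lb_p_def by blast

lemma subst_s_ex:
  assumes "level a = set_level x" shows "\<exists>y. subst_s z a x y"
  using subst_ok_ex[OF assms finite_levels(2)[of z], of "Suc (dep_s z)"]
  unfolding subst_ok_def lb_s_def by blast

definition sub_p :: "'a::atoms ipred \<Rightarrow> 'a \<Rightarrow> 'a iset \<Rightarrow> 'a ipred" (\<open>_[_ \<mapsto> _]\<^sub>p\<close> [1000, 0, 0] 1000) where
  "X[a \<mapsto> x]\<^sub>p = (THE X'. subst_p X a x X')"

definition sub_s :: "'a::atoms iset \<Rightarrow> 'a \<Rightarrow> 'a iset \<Rightarrow> 'a iset" (\<open>_[_ \<mapsto> _]\<^sub>s\<close> [1000, 0, 0] 1000) where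
  "z[a \<mapsto> x]\<^sub>s = (THE z'. subst_s z a x z')"

lemma sub_p_eqI: "subst_p X a x X' \<Longrightarrow> level a = set_level x \<Longrightarrow> X[a \<mapsto> x]\<^sub>p = X'"
  unfolding sub_p_def by (blast intro: subst_unique(1))

lemma sub_s_eqI: "subst_s z a x z' \<Longrightarrow> level a = set_level x \<Longrightarrow> z[a \<mapsto> x]\<^sub>s = z'"
  unfolding sub_s_def by (blast intro: subst_unique(2))

lemma subst_p_sub: "level a = set_level x \<Longrightarrow> subst_p X a x (X[a \<mapsto> x]\<^sub>p)"
  using subst_p_ex sub_p_eqI by metis

lemma subst_s_sub: "level a = set_level x \<Longrightarrow> subst_s z a x (z[a \<mapsto> x]\<^sub>s)"
  using subst_s_ex sub_s_eqI by metis

lemma sub_level: "level a = set_level x \<Longrightarrow> set_level (z[a \<mapsto> x]\<^sub>s) = set_level z"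
  using subst_level(2)[OF subst_s_sub] by blast

lemma sub_simps:
  assumes "level a = set_level x"
  shows "(Conj XX)[a \<mapsto> x]\<^sub>p = Conj ((\<lambda>X. X[a \<mapsto> x]\<^sub>p) |`| XX)"
    "(Neg X)[a \<mapsto> x]\<^sub>p = Neg (X[a \<mapsto> x]\<^sub>p)"
    "b \<noteq> a \<Longrightarrow> b \<notin> free_s x \<Longrightarrow> (Forall b X)[a \<mapsto> x]\<^sub>p = Forall b (X[a \<mapsto> x]\<^sub>p)"
    "level b = set_level y + 1 \<Longrightarrow> b \<noteq> a \<Longrightarrow> (Mem y b)[a \<mapsto> x]\<^sub>p = Mem (y[a \<mapsto> x]\<^sub>s) b"
    "(Atm a)[a \<mapsto> x]\<^sub>s = x"
    "b \<noteq> a \<Longrightarrow> (Atm b)[a \<mapsto> x]\<^sub>s = Atm b"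
    "c \<noteq> a \<Longrightarrow> c \<notin> free_s x \<Longrightarrow> (Abs c X)[a \<mapsto> x]\<^sub>s = Abs c (X[a \<mapsto> x]\<^sub>p)"
proof -
  note [simp] = assms subst_p_sub subst_s_sub
  show "(Conj XX)[a \<mapsto> x]\<^sub>p = Conj ((\<lambda>X. X[a \<mapsto> x]\<^sub>p) |`| XX)"
    by (intro sub_p_eqI subst_Conj) simp_all
  show "(Neg X)[a \<mapsto> x]\<^sub>p = Neg (X[a \<mapsto> x]\<^sub>p)"
    by (intro sub_p_eqI subst_Neg) simp_all
  show "b \<noteq> a \<Longrightarrow> b \<notin> free_s x \<Longrightarrow> (Forall b X)[a \<mapsto> x]\<^sub>p = Forall b (X[a \<mapsto> x]\<^sub>p)"
    by (intro sub_p_eqI subst_Forall) simp_all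
  show "level b = set_level y + 1 \<Longrightarrow> b \<noteq> a \<Longrightarrow> (Mem y b)[a \<mapsto> x]\<^sub>p = Mem (y[a \<mapsto> x]\<^sub>s) b"
    by (intro sub_p_eqI subst_Mem_other) simp_all
  show "(Atm a)[a \<mapsto> x]\<^sub>s = x"
    by (intro sub_s_eqI subst_Atm) simp_all
  show "b \<noteq> a \<Longrightarrow> (Atm b)[a \<mapsto> x]\<^sub>s = Atm b"
    by (intro sub_s_eqI subst_Atm_other) simp_all
  show "c \<noteq> a \<Longrightarrow> c \<notin> free_s x \<Longrightarrow> (Abs c X)[a \<mapsto> x]\<^sub>s = Abs c (X[a \<mapsto> x]\<^sub>p)"
    by (intro sub_s_eqI subst_Abs) simp_all
qed

lemma sub_Mem_Atm:
  assumes "level a = level n" "level a = set_level y + 1"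
  shows "(Mem y a)[a \<mapsto> Atm n]\<^sub>p = Mem (y[a \<mapsto> Atm n]\<^sub>s) n"
  using assms by (intro sub_p_eqI subst_Mem_Atm subst_s_sub) auto

lemma sub_Mem_Abs:
  assumes "level a = set_level y + 1" "level a = level a' + 1" "a' \<notin> free_s y"
  shows "(Mem y a)[a \<mapsto> Abs a' X]\<^sub>p = X[a' \<mapsto> y[a \<mapsto> Abs a' X]\<^sub>s]\<^sub>p"
  using assms
  by (intro sub_p_eqI subst_Mem_Abs[OF _ subst_s_sub _ _ subst_p_sub]) (auto simp: sub_level)

definition prepoint :: "('a::atoms \<times> 'a iset) set \<Rightarrow> bool" where
  "prepoint p \<longleftrightarrow> (\<forall>(a, y) \<in> p. level a = set_level y + 1)"

definition generously_names :: "('a::atoms \<times> 'a iset) set \<Rightarrow> bool" where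
  "generously_names p \<longleftrightarrow> (\<forall>a' a X. level a = level a' \<longrightarrow>
     generous {a'' \<in> \<A> (level a'). p \<Turnstile> swap_p a'' a X \<longleftrightarrow> p \<Turnstile> X[a \<mapsto> Atm a']\<^sub>p})"

inductive entails :: "'a::atoms ipred fset \<Rightarrow> 'a ipred fset \<Rightarrow> bool" (infix \<open>\<turnstile>\<close> 50) where
  Conj_L: "\<Gamma> |\<union>| XX \<turnstile> \<Delta> \<Longrightarrow> finsert (Conj XX) \<Gamma> \<turnstile> \<Delta>"
| Conj_R: "(\<And>X. X |\<in>| XX \<Longrightarrow> \<Gamma> \<turnstile> finsert X \<Delta>) \<Longrightarrow> \<Gamma> \<turnstile> finsert (Conj XX) \<Delta>"
| Neg_L: "\<Gamma> \<turnstile> finsert X \<Delta> \<Longrightarrow> finsert (Neg X) \<Gamma> \<turnstile> \<Delta>"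
| Neg_R: "finsert X \<Gamma> \<turnstile> \<Delta> \<Longrightarrow> \<Gamma> \<turnstile> finsert (Neg X) \<Delta>"
| Forall_L: "level a' = level a \<Longrightarrow> finsert (X[a \<mapsto> Atm a']\<^sub>p) \<Gamma> \<turnstile> \<Delta> \<Longrightarrow> finsert (Forall a X) \<Gamma> \<turnstile> \<Delta>"
| Forall_R: "New (level a) (\<lambda>a'. \<Gamma> \<turnstile> finsert (swap_p a' a X) \<Delta>) \<Longrightarrow> \<Gamma> \<turnstile> finsert (Forall a X) \<Delta>"
| Ax: "finsert X \<Gamma> \<turnstile> finsert X \<Delta>"
| Cut: "finsert X \<Gamma> \<turnstile> \<Delta> \<Longrightarrow> \<Gamma> \<turnstile> finsert X \<Delta> \<Longrightarrow> \<Gamma> \<turnstile> \<Delta>"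

definition entails_sets :: "'a::atoms ipred set \<Rightarrow> 'a ipred set \<Rightarrow> bool" where
  "entails_sets A B \<longleftrightarrow> (\<exists>\<Gamma> \<Delta>. fset \<Gamma> \<subseteq> A \<and> fset \<Delta> \<subseteq> B \<and> \<Gamma> \<turnstile> \<Delta>)"

definition valid_sets :: "('a::atoms \<times> 'a iset) set \<Rightarrow> 'a ipred set \<Rightarrow> 'a ipred set \<Rightarrow> bool" where
  "valid_sets p A B \<longleftrightarrow> ((\<forall>X \<in> A. p \<Turnstile> X) \<longrightarrow> (\<exists>Y \<in> B. p \<Turnstile> Y))"

end

theory Submission
  imports Defs
begin

text \<open>Soundness is by induction on derivations. The propositional rules are classical truth
  tables, and the right rule for the quantifier matches its semantics, both using
  \<open>New\<close>. The left rule is the crux: truth of \<open>Forall a X\<close> gives truth of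
  \<open>swap_p a'' a X\<close> for all but a small set of \<open>a''\<close>, while the rule asks
  for the substitution instance at one given \<open>a'\<close>. Generous naming provides a generous
  set of \<open>a''\<close> at which the two agree in truth value, and a generous set cannot lie in
  a small one (\<open>valid_Forall_instance\<close>). Part (2) follows because validity survives
  enlarging both sides.\<close>

lemma small_not_generous:
  assumes "small (S :: 'a::atoms set)"
  shows "\<not> generous S"
proof
  assume "generous S"
  from assms obtain C :: "'a set" where C: "has_card_beth_omega C" "|S| <o |C|"
    unfolding small_def by blast
  have "|C| =o |S|"
    using has_card_beth_omega_unique C(1) \<open>generous S\<close> unfolding generous_def by blast
  then show False
    using C(2) not_ordLess_ordIso ordIso_symmetric by blast
qed

text \<open>If there were no common atom, the generous set would lie inside the small complement of
  the other.\<close>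

lemma New_generous_ex:
  assumes "New i \<Phi>" "generous {a \<in> \<A> i. \<Psi> a}"
  shows "\<exists>a. level a = i \<and> \<Phi> a \<and> \<Psi> a"
proof (rule ccontr)
  assume "\<nexists>a. level a = i \<and> \<Phi> a \<and> \<Psi> a"
  then have "{a \<in> \<A> i. \<Psi> a} \<subseteq> \<A> i - {a \<in> \<A> i. \<Phi> a}" by auto
  with assms(1) have "small {a \<in> \<A> i. \<Psi> a}"
    unfolding New_def by (rule small_subset)
  with assms(2) show False using small_not_generous by blast
qed

text \<open>At a common atom \<open>a''\<close>, the swapped instance is true and equivalent to the
  substitution instance at \<open>a'\<close>.\<close>

lemma valid_Forall_instance:
  assumes "generously_names p" "level a' = level a" "p \<Turnstile> Forall a X"
  shows "p \<Turnstile> X[a \<mapsto> Atm a']\<^sub>p"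
proof -
  have "New (level a') (\<lambda>a''. p \<Turnstile> swap_p a'' a X)" using assms(2,3) by simp
  moreover have "generous {a'' \<in> \<A> (level a'). p \<Turnstile> swap_p a'' a X \<longleftrightarrow> p \<Turnstile> X[a \<mapsto> Atm a']\<^sub>p}"
    using assms(1) assms(2)[symmetric] unfolding generously_names_def by blast
  ultimately show ?thesis by (auto dest: New_generous_ex)
qed

lemma entails_sound:
  assumes "generously_names p"
  shows "\<Gamma> \<turnstile> \<Delta> \<Longrightarrow> valid_sets p (fset \<Gamma>) (fset \<Delta>)"
proof (induction rule: entails.induct)
  case (Forall_L a' a X \<Gamma> \<Delta>)
  then show ?case using valid_Forall_instance[OF assms] unfolding valid_sets_def by simp
next
  case (Forall_R a \<Gamma> X \<Delta>)
  show ?case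
  proof (cases "(\<forall>Y |\<in>| \<Gamma>. p \<Turnstile> Y) \<and> \<not> (\<exists>Y |\<in>| \<Delta>. p \<Turnstile> Y)")
    case True
    \<comment> \<open>With all of \<Gamma> true and all of \<Delta> false, each premise can only be
      valid through its swapped instance. Outside this case the conclusion is immediate.\<close>
    from Forall_R have "New (level a) (\<lambda>a'. p \<Turnstile> swap_p a' a X)"
      by (rule New_mono) (use True in \<open>auto simp: valid_sets_def\<close>)
    then show ?thesis by (simp add: valid_sets_def)
  qed (auto simp: valid_sets_def)
next
  case (Conj_R XX \<Gamma> \<Delta>)
  then show ?case by (fastforce simp: valid_sets_def)
qed (auto simp: valid_sets_def)

theorem theorem12p11:
  fixes p :: "('a::atoms \<times> 'a iset) set"
    and A B :: "'a ipred set"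
    and \<Gamma> \<Delta> :: "'a ipred fset"
  assumes "prepoint p" and "generously_names p"
  shows "(\<Gamma> \<turnstile> \<Delta> \<longrightarrow> valid_sets p (fset \<Gamma>) (fset \<Delta>)) \<and>
    (entails_sets A B \<longrightarrow> valid_sets p A B)"
proof (intro conjI impI)
  show "valid_sets p (fset \<Gamma>) (fset \<Delta>)" if "\<Gamma> \<turnstile> \<Delta>"
    using entails_sound[OF assms(2) that] .
  assume "entails_sets A B"
  then obtain \<Gamma> \<Delta> where "fset \<Gamma> \<subseteq> A" "fset \<Delta> \<subseteq> B" "\<Gamma> \<turnstile> \<Delta>"
    unfolding entails_sets_def by blast
  with entails_sound[OF assms(2), of \<Gamma> \<Delta>] show "valid_sets p A B"
    unfolding valid_sets_def by blast
qed

end
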